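(* There exists a finite soluble primitive permutation group $G$ with $\mathcal{G}(G) > 4$.
   Context: For a subgroup $G$ of $\mathrm{Sym}(\Delta)$ with $\Delta$ finite, the greedy base size $\mathcal{G}(G)$ is the maximum size of a base for $G$ (a sequence of points with trivial pointwise stabiliser) produced by the following greedy algorithm. Start with the empty sequence $\mathcal{B}_0$. At step $i \ge 1$, compute the pointwise stabiliser $G^{i-1}$ in $G$ of the current sequence $\mathcal{B}_{i-1}$, and let $\mathcal{B}_i$ be $\mathcal{B}_{i-1}$ extended by any point from a longest orbit of $G^{i-1}$ on $\Delta$. Stop when $G^i$ becomes trivial; then $\mathcal{B}_i$ is a greedy base. (The maximum is over all possible choices made by the algorithm.) *)

theory Defs
  imports "HOL-Algebra.Group_Action" "HOL-Algebra.Solvable_Groups"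
begin

text \<open>Permutation groups are subgroups \<open>G\<close> of \<^term>\<open>BijGroup \<Delta>\<close>, the library's
  symmetric group on \<open>\<Delta>\<close>, whose elements are extensional functions on \<open>\<Delta>\<close>.\<close>

abbreviation perm_group :: "'a set \<Rightarrow> ('a \<Rightarrow> 'a) set \<Rightarrow> ('a \<Rightarrow> 'a) monoid"
  where "perm_group \<Delta> G \<equiv> (BijGroup \<Delta>)\<lparr>carrier := G\<rparr>"

definition perm_block :: "'a set \<Rightarrow> ('a \<Rightarrow> 'a) set \<Rightarrow> 'a set \<Rightarrow> bool"
  where "perm_block \<Delta> G B \<longleftrightarrow>
    B \<subseteq> \<Delta> \<and> B \<noteq> {} \<and> (\<forall>g\<in>G. g ` B = B \<or> g ` B \<inter> B = {})"

definition primitive_perm_group :: "'a set \<Rightarrow> ('a \<Rightarrow> 'a) set \<Rightarrow> bool"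
  where "primitive_perm_group \<Delta> G \<longleftrightarrow>
    \<Delta> \<noteq> {} \<and> subgroup G (BijGroup \<Delta>) \<and>
    transitive_action (perm_group \<Delta> G) \<Delta> (\<lambda>g. g) \<and>
    (\<forall>B. perm_block \<Delta> G B \<longrightarrow> B = \<Delta> \<or> (\<exists>x. B = {x}))"

definition pointwise_stabilizer :: "('a \<Rightarrow> 'a) set \<Rightarrow> 'a list \<Rightarrow> ('a \<Rightarrow> 'a) set"
  where "pointwise_stabilizer G xs = {g \<in> G. \<forall>x\<in>set xs. g x = x}"

definition perm_base :: "'a set \<Rightarrow> ('a \<Rightarrow> 'a) set \<Rightarrow> 'a list \<Rightarrow> bool"
  where "perm_base \<Delta> G xs \<longleftrightarrow>
    set xs \<subseteq> \<Delta> \<and> pointwise_stabilizer G xs = {\<one>\<^bsub>BijGroup \<Delta>\<^esub>}"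

definition in_longest_orbit :: "'a set \<Rightarrow> ('a \<Rightarrow> 'a) set \<Rightarrow> 'a \<Rightarrow> bool"
  where "in_longest_orbit \<Delta> G x \<longleftrightarrow> x \<in> \<Delta> \<and>
    (\<forall>y\<in>\<Delta>. card (orbit (perm_group \<Delta> G) (\<lambda>g. g) y)
           \<le> card (orbit (perm_group \<Delta> G) (\<lambda>g. g) x))"

text \<open>The sequences reachable by the greedy algorithm, including those at which it has not
  yet stopped.\<close>

inductive greedy_seq :: "'a set \<Rightarrow> ('a \<Rightarrow> 'a) set \<Rightarrow> 'a list \<Rightarrow> bool"
  for \<Delta> G where
    start: "greedy_seq \<Delta> G []"
  | step: "\<lbrakk> greedy_seq \<Delta> G xs; \<not> perm_base \<Delta> G xs;
             in_longest_orbit \<Delta> (pointwise_stabilizer G xs) x \<rbrakk>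
           \<Longrightarrow> greedy_seq \<Delta> G (xs @ [x])"

definition greedy_base :: "'a set \<Rightarrow> ('a \<Rightarrow> 'a) set \<Rightarrow> 'a list \<Rightarrow> bool"
  where "greedy_base \<Delta> G xs \<longleftrightarrow> greedy_seq \<Delta> G xs \<and> perm_base \<Delta> G xs"

text \<open>For finite \<open>\<Delta>\<close> the maximum is over a finite nonempty set; see
  \<open>finite_greedy_bases\<close> and \<open>greedy_base_exists\<close> below.\<close>

definition greedy_base_size :: "'a set \<Rightarrow> ('a \<Rightarrow> 'a) set \<Rightarrow> nat"
  where "greedy_base_size \<Delta> G = Max (length ` {xs. greedy_base \<Delta> G xs})"

lemma greedy_seq_subset: "greedy_seq \<Delta> G xs \<Longrightarrow> set xs \<subseteq> \<Delta>"
  by (induction rule: greedy_seq.induct) (auto simp: in_longest_orbit_def)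

lemma one_in_pointwise_stabilizer:
  assumes "subgroup G (BijGroup \<Delta>)" "set xs \<subseteq> \<Delta>"
  shows "\<one>\<^bsub>BijGroup \<Delta>\<^esub> \<in> pointwise_stabilizer G xs"
  using assms subgroup.one_closed[OF assms(1)]
  by (auto simp: pointwise_stabilizer_def BijGroup_def)

lemma greedy_seq_distinct:
  assumes "finite \<Delta>" "subgroup G (BijGroup \<Delta>)" "greedy_seq \<Delta> G xs"
  shows "distinct xs"
  using assms(3)
proof induction
  case (step xs x)
  let ?S = "pointwise_stabilizer G xs"
  let ?o = "orbit (perm_group \<Delta> ?S) (\<lambda>g. g)"
  have sub: "set xs \<subseteq> \<Delta>" using step.hyps(1) by (rule greedy_seq_subset)
  have one: "\<one>\<^bsub>BijGroup \<Delta>\<^esub> \<in> ?S" using assms(2) sub by (rule one_in_pointwise_stabilizer)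
  have bij: "g \<in> Bij \<Delta>" if "g \<in> ?S" for g
    using that subgroup.subset[OF assms(2)] by (auto simp: pointwise_stabilizer_def BijGroup_def)
  have "x \<notin> set xs"
  proof
    assume "x \<in> set xs"
    then have "?o x \<subseteq> {x}" by (auto simp: orbit_def pointwise_stabilizer_def)
    then have "card (?o x) \<le> 1" using card_mono[of "{x}" "?o x"] by simp
    then have le: "card (?o y) \<le> 1" if "y \<in> \<Delta>" for y
      using step.hyps(3) that by (fastforce simp: in_longest_orbit_def)
    have "g = \<one>\<^bsub>BijGroup \<Delta>\<^esub>" if g: "g \<in> ?S" for g
    proof -
      have "g y = y" if y: "y \<in> \<Delta>" for y
      proof -
        have "?o y \<subseteq> \<Delta>" using bij y by (auto simp: orbit_def dest: Bij_imp_funcset)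
        then have fin: "finite (?o y)" using assms(1) finite_subset by blast
        have self: "h y \<in> ?o y" if "h \<in> ?S" for h using that by (auto simp: orbit_def)
        have "\<one>\<^bsub>BijGroup \<Delta>\<^esub> y = y" using y by (simp add: BijGroup_def)
        with self[OF one] have "y \<in> ?o y" by (simp only:)
        moreover have "g y \<in> ?o y" using g by (auto simp: orbit_def)
        ultimately show ?thesis
          using le[OF y] card_le_Suc0_iff_eq[OF fin] by auto
      qed
      then show ?thesis
        using Bij_imp_extensional[OF bij[OF g]]
        by (auto simp: BijGroup_def extensional_def fun_eq_iff)
    qed
    with one have "?S = {\<one>\<^bsub>BijGroup \<Delta>\<^esub>}" by blast
    then have "perm_base \<Delta> G xs" using sub by (simp add: perm_base_def)
    with step.hyps(2) show False by simp
  qed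
  with step.IH show ?case by simp
qed simp

lemma finite_greedy_bases:
  assumes "finite \<Delta>" "subgroup G (BijGroup \<Delta>)"
  shows "finite {xs. greedy_base \<Delta> G xs}"
  using finite_subset_distinct[OF assms(1)]
  by (rule rev_finite_subset)
     (use assms in \<open>auto simp: greedy_base_def dest: greedy_seq_subset greedy_seq_distinct\<close>)

lemma greedy_base_exists:
  assumes "finite \<Delta>" "subgroup G (BijGroup \<Delta>)"
  shows "\<exists>xs. greedy_base \<Delta> G xs"
proof -
  have len: "length xs \<le> card \<Delta>" if "greedy_seq \<Delta> G xs" for xs
    using greedy_seq_subset[OF that] greedy_seq_distinct[OF assms that]
      card_mono[OF assms(1), of "set xs"] by (simp add: distinct_card)
  have "\<exists>zs. greedy_base \<Delta> G zs" if "greedy_seq \<Delta> G xs" for xs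
    using that
  proof (induction "card \<Delta> - length xs" arbitrary: xs rule: less_induct)
    case less
    show ?case
    proof (cases "perm_base \<Delta> G xs")
      case True
      with less.prems show ?thesis by (auto simp: greedy_base_def)
    next
      case False
      let ?S = "pointwise_stabilizer G xs"
      let ?o = "orbit (perm_group \<Delta> ?S) (\<lambda>g. g)"
      have "\<Delta> \<noteq> {}"
      proof
        assume emp: "\<Delta> = {}"
        have sub: "set xs \<subseteq> \<Delta>" using less.prems by (rule greedy_seq_subset)
        have one: "\<one>\<^bsub>BijGroup \<Delta>\<^esub> \<in> ?S" using assms(2) sub by (rule one_in_pointwise_stabilizer)
        have ext: "g \<in> extensional \<Delta>" if "g \<in> ?S" for g
          using that subgroup.subset[OF assms(2)]
          by (auto simp: pointwise_stabilizer_def BijGroup_def Bij_def)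
        have "g = \<one>\<^bsub>BijGroup \<Delta>\<^esub>" if "g \<in> ?S" for g
          using ext[OF that] ext[OF one] by (rule extensionalityI) (simp add: emp)
        with one have "?S = {\<one>\<^bsub>BijGroup \<Delta>\<^esub>}" by blast
        with sub False show False by (simp add: perm_base_def)
      qed
      let ?m = "Max ((\<lambda>y. card (?o y)) ` \<Delta>)"
      have "?m \<in> (\<lambda>y. card (?o y)) ` \<Delta>" using assms(1) \<open>\<Delta> \<noteq> {}\<close> by (intro Max_in) auto
      then obtain x where x: "x \<in> \<Delta>" "card (?o x) = ?m" by force
      have "card (?o y) \<le> ?m" if "y \<in> \<Delta>" for y using assms(1) that by (intro Max_ge) auto
      then have "in_longest_orbit \<Delta> ?S x" unfolding in_longest_orbit_def using x by simp
      with less.prems False have gs: "greedy_seq \<Delta> G (xs @ [x])" by (rule greedy_seq.step)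
      with len[OF gs] show ?thesis by (intro less.hyps[OF _ gs]) auto
    qed
  qed
  then show ?thesis using greedy_seq.start by blast
qed

end

theory Submission
  imports Defs "HOL-Combinatorics.Transposition"
begin

text \<open>The group is \<open>S\<^sub>4 wr S\<^sub>4 wr S\<^sub>4\<close> in product action on the \<open>4 \<times> 4\<close> arrays with entries in a set of
  four points, one of which is called zero. The stabiliser of the zero array is
  \<open>S\<^sub>3 wr S\<^sub>4 wr S\<^sub>4\<close>, and the orbit of an array consists of the arrays whose rows have, up to order,
  the same numbers of zeros. There are \<open>81, 108, 54, 12, 1\<close> rows with \<open>0, 1, 2, 3, 4\<close> zeros, so breaking
  the symmetry between the rows pays off: a longest orbit belongs to the row pattern \<open>2, 0, 1, 1\<close>.
  Its stabiliser acts on the two zeros of the first row as \<open>S\<^sub>3 wr S\<^sub>2\<close>, independently of all other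
  coordinates. On these two coordinates the greedy algorithm may next choose two equal values and
  then two equal values again, after which the transposition of the two coordinates still survives.
  So four points do not suffice.\<close>

section \<open>Groups of permutations of a finite type\<close>

text \<open>The group is built on a function type with plain composition. Relabelling carries its
  elements along an injection \<open>e\<close> to the extensional functions that make up
  \<open>BijGroup (range e)\<close>.\<close>

definition relabel :: "('p \<Rightarrow> 'a) \<Rightarrow> ('p \<Rightarrow> 'p) \<Rightarrow> 'a \<Rightarrow> 'a"
  where "relabel e f = restrict (e \<circ> f \<circ> Hilbert_Choice.inv e) (range e)"

definition perm_closed :: "('p \<Rightarrow> 'p) set \<Rightarrow> bool"
  where "perm_closed W \<longleftrightarrow> id \<in> W \<and> (\<forall>f\<in>W. bij f \<and> Hilbert_Choice.inv f \<in> W) \<and> (\<forall>f\<in>W. \<forall>h\<in>W. f \<circ> h \<in> W)"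

definition fixer :: "('p \<Rightarrow> 'p) set \<Rightarrow> 'p set \<Rightarrow> ('p \<Rightarrow> 'p) set"
  where "fixer W Q = {f \<in> W. \<forall>q\<in>Q. f q = q}"

definition orb :: "('p \<Rightarrow> 'p) set \<Rightarrow> 'p \<Rightarrow> 'p set"
  where "orb S x = (\<lambda>f. f x) ` S"

context
  fixes e :: "'p \<Rightarrow> 'a"
  assumes e: "inj e"
begin

lemma relabel_apply [simp]: "relabel e f (e x) = e (f x)"
  using e by (simp add: relabel_def)

lemma relabel_eq_iff: "relabel e f = relabel e h \<longleftrightarrow> f = h"
proof
  assume "relabel e f = relabel e h"
  then have "e (f x) = e (h x)" for x by (metis relabel_apply)
  then show "f = h" using e by (auto dest: injD)
qed simp

lemma relabel_Bij: "bij f \<Longrightarrow> relabel e f \<in> Bij (range e)"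
proof -
  assume f: "bij f"
  have "bij_betw (e \<circ> f \<circ> Hilbert_Choice.inv e) (range e) (range e)"
    using f e by (intro bij_betw_trans[of _ _ UNIV])
      (auto simp: bij_betw_def intro: inj_on_inv_into)
  then show ?thesis unfolding Bij_def relabel_def by simp
qed

lemma relabel_mult:
  "bij f \<Longrightarrow> bij h \<Longrightarrow> relabel e f \<otimes>\<^bsub>BijGroup (range e)\<^esub> relabel e h = relabel e (f \<circ> h)"
  using relabel_Bij by (auto simp: BijGroup_def compose_def fun_eq_iff relabel_def e)

lemma relabel_one: "\<one>\<^bsub>BijGroup (range e)\<^esub> = relabel e id"
  by (auto simp: BijGroup_def relabel_def fun_eq_iff e)

lemma relabel_inv:
  assumes "bij f"
  shows "inv\<^bsub>BijGroup (range e)\<^esub> (relabel e f) = relabel e (Hilbert_Choice.inv f)"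
proof (rule group.inv_equality[OF group_BijGroup])
  have "Hilbert_Choice.inv f \<circ> f = id" using assms by (auto simp: bij_def)
  then show "relabel e (Hilbert_Choice.inv f) \<otimes>\<^bsub>BijGroup (range e)\<^esub> relabel e f = \<one>\<^bsub>BijGroup (range e)\<^esub>"
    using assms by (simp add: relabel_mult relabel_one bij_imp_bij_inv)
  show "relabel e f \<in> carrier (BijGroup (range e))"
    "relabel e (Hilbert_Choice.inv f) \<in> carrier (BijGroup (range e))"
    using assms relabel_Bij by (auto simp: BijGroup_def bij_imp_bij_inv)
qed

lemma subgroup_relabel:
  assumes "perm_closed W"
  shows "subgroup (relabel e ` W) (BijGroup (range e))"
proof (rule subgroup.intro)
  show "relabel e ` W \<subseteq> carrier (BijGroup (range e))"
    using assms relabel_Bij by (auto simp: perm_closed_def BijGroup_def)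
qed (use assms in \<open>auto simp: perm_closed_def relabel_mult relabel_one relabel_inv\<close>)

text \<open>By induction the \<open>k\<close>-th derived subgroup lies in the image of
  \<open>C k\<close>, so it is trivial at \<open>k = n\<close>.\<close>

lemma solvable_relabel:
  assumes closed: "\<And>k. perm_closed (C k)"
    and comm: "\<And>k f h. f \<in> C k \<Longrightarrow> h \<in> C k \<Longrightarrow> f \<circ> h \<circ> Hilbert_Choice.inv f \<circ> Hilbert_Choice.inv h \<in> C (Suc k)"
    and triv: "C n = {id}"
  shows "solvable (perm_group (range e) (relabel e ` C 0))"
proof -
  let ?B = "BijGroup (range e)" and ?G = "relabel e ` C 0"
  interpret B: group ?B by (rule group_BijGroup)
  have sub: "subgroup (relabel e ` C k) ?B" for k using closed by (rule subgroup_relabel)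
  interpret G: group "perm_group (range e) ?G"
    using sub by (rule B.subgroup_imp_group)
  have bij: "bij f" if "f \<in> C k" for f k using closed[of k] that by (auto simp: perm_closed_def)
  have der: "derived ?B (relabel e ` C k) \<subseteq> relabel e ` C (Suc k)" for k
    unfolding derived_def
  proof (rule B.generate_subgroup_incl[OF _ sub])
    show "derived_set ?B (relabel e ` C k) \<subseteq> relabel e ` C (Suc k)"
      using comm bij by (force simp: relabel_mult relabel_inv bij_comp bij_imp_bij_inv)
  qed
  have pow: "(derived ?B ^^ k) ?G \<subseteq> relabel e ` C k" for k
  proof (induction k)
    case (Suc k)
    have "derived ?B ((derived ?B ^^ k) ?G) \<subseteq> derived ?B (relabel e ` C k)"
      using Suc subgroup.subset[OF sub] by (intro B.mono_derived) auto
    with der show ?case by fastforce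
  qed simp
  have "(derived ?B ^^ n) ?G = {\<one>\<^bsub>?B\<^esub>}"
    using pow[of n] subgroup.one_closed[OF B.exp_of_derived_is_subgroup[OF sub[of 0]], of n]
    by (auto simp: triv relabel_one)
  \<comment> \<open>Solubility refers to derived subgroups formed inside the subgroup structure.
    They agree with those formed in \<open>BijGroup (range e)\<close> because every term of the
    series stays inside the group.\<close>
  moreover have "(derived (perm_group (range e) ?G) ^^ k) ?G = (derived ?B ^^ k) ?G \<and>
      (derived ?B ^^ k) ?G \<subseteq> ?G" for k
  proof (induction k)
    case (Suc k)
    have "derived ?B ((derived ?B ^^ k) ?G) \<subseteq> ?G"
      using B.derived_incl[OF _ sub[of 0]] Suc by blast
    with Suc show ?case using B.derived_consistent[OF _ sub[of 0]] by simp
  qed simp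
  ultimately have "(derived (perm_group (range e) ?G) ^^ n) ?G = {\<one>\<^bsub>perm_group (range e) ?G\<^esub>}"
    by simp
  then show ?thesis using G.solvable_iff_trivial_derived_seq by auto
qed

text \<open>Blocks pull back along the injection \<open>e\<close>, so primitivity can be checked on
  the original type, in the form that a block with two distinct points is everything.\<close>

lemma primitive_relabel:
  assumes W: "perm_closed W"
    and trans: "\<And>x y. \<exists>f\<in>W. f x = y"
    and prim: "\<And>B x y. x \<in> B \<Longrightarrow> y \<in> B \<Longrightarrow> x \<noteq> y \<Longrightarrow>
      (\<And>f. f \<in> W \<Longrightarrow> f ` B = B \<or> f ` B \<inter> B = {}) \<Longrightarrow> B = UNIV"
  shows "primitive_perm_group (range e) (relabel e ` W)"
proof -
  let ?B = "BijGroup (range e)" and ?G = "relabel e ` W"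
  interpret B: group ?B by (rule group_BijGroup)
  have sub: "subgroup ?G ?B" using W by (rule subgroup_relabel)
  have hom: "group_hom (perm_group (range e) ?G) ?B (\<lambda>g. g)"
    using subgroup.subset[OF sub] B.subgroup_imp_group[OF sub] B.group_axioms
    by (auto simp: group_hom_def group_hom_axioms_def hom_def)
  have "transitive_action (perm_group (range e) ?G) (range e) (\<lambda>g. g)"
    unfolding transitive_action_def group_action_def transitive_action_axioms_def
  proof (intro conjI hom allI impI)
    fix x y assume "x \<in> range e" "y \<in> range e"
    then obtain a b where "x = e a" "y = e b" by blast
    with trans[of a b] show "\<exists>g\<in>carrier (perm_group (range e) ?G). g x = y" by auto
  qed
  moreover have "D = range e \<or> (\<exists>x. D = {x})" if D: "perm_block (range e) ?G D" for D
  proof -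
    define E where "E = e -` D"
    have DE: "D = e ` E" using D by (auto simp: E_def perm_block_def)
    have "E \<noteq> {}" using D DE by (auto simp: perm_block_def)
    have blk: "f ` E = E \<or> f ` E \<inter> E = {}" if "f \<in> W" for f
    proof -
      have im: "relabel e f ` e ` E = e ` f ` E" by (simp add: image_image)
      have "relabel e f ` D = D \<or> relabel e f ` D \<inter> D = {}"
        using D that by (auto simp: perm_block_def)
      then have "e ` f ` E = e ` E \<or> e ` f ` E \<inter> e ` E = {}" unfolding DE im .
      then show ?thesis using e by (auto simp: inj_image_eq_iff image_Int[symmetric])
    qed
    show ?thesis
    proof (cases "\<exists>x. E = {x}")
      case False
      with \<open>E \<noteq> {}\<close> obtain x y where "x \<in> E" "y \<in> E" "x \<noteq> y" by blast
      then have "E = UNIV" using prim blk by blast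
      then show ?thesis by (simp add: DE)
    qed (auto simp: DE)
  qed
  ultimately show ?thesis using sub by (auto simp: primitive_perm_group_def)
qed

section \<open>Stabilisers, orbits and greedy steps under relabelling\<close>

lemma pointwise_stabilizer_relabel:
  "pointwise_stabilizer (relabel e ` W) (map e xs) = relabel e ` fixer W (set xs)"
proof -
  have "(\<forall>x\<in>set (map e xs). relabel e f x = x) \<longleftrightarrow> (\<forall>x\<in>set xs. f x = x)" for f
    using e by (auto dest: injD)
  then show ?thesis unfolding pointwise_stabilizer_def fixer_def by blast
qed

lemma card_orbit_relabel:
  "card (orbit (perm_group (range e) (relabel e ` S)) (\<lambda>g. g) (e x)) = card (orb S x)"
proof -
  have "orbit (perm_group (range e) (relabel e ` S)) (\<lambda>g. g) (e x) = e ` orb S x"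
    unfolding orbit_def orb_def Setcompr_eq_image by (simp add: image_image)
  then show ?thesis using e by (simp add: card_image inj_on_subset)
qed

text \<open>The nontrivial element \<open>f\<close> of the stabiliser certifies that the algorithm
  has not stopped at \<open>xs\<close>.\<close>

lemma greedy_seq_relabel_step:
  assumes "greedy_seq (range e) (relabel e ` W) (map e xs)"
    and "f \<in> fixer W (set xs)" "f \<noteq> id"
    and "\<And>y. card (orb (fixer W (set xs)) y) \<le> card (orb (fixer W (set xs)) x)"
  shows "greedy_seq (range e) (relabel e ` W) (map e (xs @ [x]))"
proof -
  have "relabel e f \<in> relabel e ` fixer W (set xs)" "relabel e f \<noteq> relabel e id"
    using assms by (auto simp: relabel_eq_iff)
  then have "\<not> perm_base (range e) (relabel e ` W) (map e xs)"
    unfolding perm_base_def pointwise_stabilizer_relabel relabel_one by blast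
  moreover have "in_longest_orbit (range e)
      (pointwise_stabilizer (relabel e ` W) (map e xs)) (e x)"
    using assms(4)
    by (auto simp: in_longest_orbit_def pointwise_stabilizer_relabel card_orbit_relabel)
  ultimately show ?thesis using greedy_seq.step[OF assms(1)] by simp
qed

end

section \<open>Lower bounds for the greedy base size from unfinished sequences\<close>

lemma greedy_seq_extends:
  assumes fin: "finite \<Delta>" "\<Delta> \<noteq> {}" and G: "subgroup G (BijGroup \<Delta>)"
    and "greedy_seq \<Delta> G xs"
  shows "\<exists>ys. greedy_base \<Delta> G (xs @ ys)"
  using assms(4)
proof (induction "card \<Delta> - length xs" arbitrary: xs rule: less_induct)
  case less
  show ?case
  proof (cases "perm_base \<Delta> G xs")
    case True
    with less.prems have "greedy_base \<Delta> G (xs @ [])" by (simp add: greedy_base_def)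
    then show ?thesis by blast
  next
    case False
    let ?c = "\<lambda>y. card (orbit (perm_group \<Delta> (pointwise_stabilizer G xs)) (\<lambda>g. g) y)"
    have "Max (?c ` \<Delta>) \<in> ?c ` \<Delta>" using fin by (intro Max_in) auto
    then obtain x where x: "x \<in> \<Delta>" "?c x = Max (?c ` \<Delta>)" by force
    have "in_longest_orbit \<Delta> (pointwise_stabilizer G xs) x"
      unfolding in_longest_orbit_def using x fin by simp
    with less.prems False have gs: "greedy_seq \<Delta> G (xs @ [x])" by (rule greedy_seq.step)
    \<comment> \<open>Greedy sequences have distinct entries, so their length is bounded and the
      induction measure drops.\<close>
    have "length (xs @ [x]) \<le> card \<Delta>"
      using greedy_seq_subset[OF gs] distinct_card[OF greedy_seq_distinct[OF fin(1) G gs]]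
        card_mono[OF fin(1), of "set (xs @ [x])"] by simp
    then have "\<exists>ys. greedy_base \<Delta> G ((xs @ [x]) @ ys)" by (intro less.hyps[OF _ gs]) auto
    then show ?thesis by auto
  qed
qed

text \<open>An unfinished greedy sequence extends to a greedy base, and the extension is proper
  because the sequence itself is not a base.\<close>

lemma length_less_greedy_base_size:
  assumes "finite \<Delta>" "\<Delta> \<noteq> {}" "subgroup G (BijGroup \<Delta>)"
    and "greedy_seq \<Delta> G xs" "\<not> perm_base \<Delta> G xs"
  shows "length xs < greedy_base_size \<Delta> G"
proof -
  obtain ys where ys: "greedy_base \<Delta> G (xs @ ys)" using greedy_seq_extends[OF assms(1-4)] by blast
  with assms(5) have "ys \<noteq> []" by (auto simp: greedy_base_def)
  then have "length xs < length (xs @ ys)" by simp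
  also have "\<dots> \<le> greedy_base_size \<Delta> G"
    unfolding greedy_base_size_def
    by (intro Max_ge finite_imageI finite_greedy_bases assms imageI) (simp add: ys)
  finally show ?thesis .
qed

section \<open>Permutations of four points\<close>

datatype four = Zero | One | Two | Three

lemma UNIV_four: "UNIV = {Zero, One, Two, Three}"
  using four.exhaust by auto

instance four :: finite
  by standard (simp add: UNIV_four)

lemma all_four: "(\<forall>x. P x) \<longleftrightarrow> P Zero \<and> P One \<and> P Two \<and> P Three"
  by (metis four.exhaust)

text \<open>Value tables turn functions on \<open>four\<close> into lists, so that finite checks can
  be done by evaluation.\<close>

definition tab :: "(four \<Rightarrow> 'b) \<Rightarrow> 'b list"
  where "tab f = [f Zero, f One, f Two, f Three]"

fun untab :: "'b list \<Rightarrow> four \<Rightarrow> 'b"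
  where "untab l Zero = l ! 0" | "untab l One = l ! 1"
  | "untab l Two = l ! 2" | "untab l Three = l ! 3"

lemma untab_tab [simp]: "untab (tab f) = f"
proof
  show "untab (tab f) x = f x" for x by (cases x) (simp_all add: tab_def)
qed

lemma tab_eq_iff: "tab f = tab g \<longleftrightarrow> f = g"
  by (metis untab_tab)

lemma tab_comp: "tab (f \<circ> g) = map f (tab g)"
  by (simp add: tab_def)

definition four_lists :: "four list list"
  where "four_lists = List.n_lists 4 [Zero, One, Two, Three]"

lemma distinct_four_lists: "distinct four_lists"
  unfolding four_lists_def by (rule distinct_n_lists) simp

lemma range_tab: "range tab = set four_lists"
proof
  show "range tab \<subseteq> set four_lists"
    using UNIV_four by (auto simp: four_lists_def set_n_lists tab_def)
  show "set four_lists \<subseteq> range tab"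
  proof
    fix l assume "l \<in> set four_lists"
    then have "length l = 4" by (simp add: four_lists_def set_n_lists)
    then have "l = tab (untab l)"
      by (simp add: tab_def numeral_eq_Suc length_Suc_conv) auto
    then show "l \<in> range tab" by blast
  qed
qed

definition sym4 :: "four list list"
  where "sym4 = filter distinct four_lists"

lemma tab_in_sym4: "tab p \<in> set sym4 \<longleftrightarrow> bij p"
proof -
  have "distinct (tab p) \<longleftrightarrow> inj p"
    by (auto simp: tab_def inj_def all_four)
  moreover have "inj p \<longleftrightarrow> bij p" by (meson bij_def finite finite_UNIV_inj_surj)
  ultimately show ?thesis using range_tab by (auto simp: sym4_def)
qed

lemma sym4_eq: "set sym4 = tab ` {p. bij p}"
proof -
  have "set sym4 \<subseteq> range tab" by (auto simp: sym4_def range_tab)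
  then show ?thesis using tab_in_sym4 by blast
qed

text \<open>The derived series \<open>S\<^sub>4 > A\<^sub>4 > V\<^sub>4 > 1\<close> as lists of value tables. Writing the commutator \<open>[p, q]\<close> as
  the \<open>r\<close> with \<open>p q = r q p\<close> avoids inverses.\<close>

definition tmult :: "four list \<Rightarrow> four list \<Rightarrow> four list"
  where "tmult p q = map (untab p) q"

lemma tmult_tab: "tmult (tab p) (tab q) = tab (p \<circ> q)"
  by (simp add: tmult_def tab_comp)

fun der4 :: "nat \<Rightarrow> four list list"
  where
    "der4 0 = sym4"
  | "der4 (Suc 0) =
      [[Zero, One, Two, Three], [One, Zero, Three, Two], [Two, Three, Zero, One],
       [Three, Two, One, Zero], [Zero, Two, Three, One], [Two, Zero, One, Three],
       [Three, One, Zero, Two], [One, Three, Two, Zero], [Zero, Three, One, Two],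
       [Three, Zero, Two, One], [One, Two, Zero, Three], [Two, One, Three, Zero]]"
  | "der4 (Suc (Suc 0)) =
      [[Zero, One, Two, Three], [One, Zero, Three, Two], [Two, Three, Zero, One], [Three, Two, One, Zero]]"
  | "der4 (Suc (Suc (Suc k))) = [[Zero, One, Two, Three]]"

text \<open>A single executable test gathers all that is needed of one step of the derived series:
  group closure of \<open>L\<close> and commutators in \<open>M\<close>.\<close>

definition closed_commutators_in :: "four list list \<Rightarrow> four list list \<Rightarrow> bool"
  where "closed_commutators_in L M \<longleftrightarrow> list_all (\<lambda>p. p \<in> set sym4
      \<and> list_ex (\<lambda>q. tmult q p = [Zero, One, Two, Three]) L
      \<and> list_all (\<lambda>q. tmult p q \<in> set L
      \<and> list_ex (\<lambda>r. tmult p q = tmult r (tmult q p)) M) L) L"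

lemma closed_commutators_in_0: "closed_commutators_in (der4 0) (der4 (Suc 0))"
  by code_simp

lemma closed_commutators_in_1: "closed_commutators_in (der4 (Suc 0)) (der4 (Suc (Suc 0)))"
  by code_simp

lemma closed_commutators_in_2: "closed_commutators_in (der4 (Suc (Suc 0))) (der4 (Suc (Suc (Suc 0))))"
  by code_simp

lemma closed_commutators_in_3: "closed_commutators_in (der4 (Suc (Suc (Suc k)))) (der4 (Suc (Suc (Suc (Suc k)))))"
  by code_simp

lemma closed_commutators_in_der4: "closed_commutators_in (der4 k) (der4 (Suc k))"
  using closed_commutators_in_0 closed_commutators_in_1 closed_commutators_in_2 closed_commutators_in_3
  by (cases k rule: der4.cases) simp_all

definition perms4 :: "nat \<Rightarrow> (four \<Rightarrow> four) set"
  where "perms4 k = {p. tab p \<in> set (der4 k)}"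

lemma perms4_0: "perms4 0 = {p. bij p}"
  by (simp add: perms4_def tab_in_sym4)

lemma perms4_ge_3: "3 \<le> k \<Longrightarrow> perms4 k = {id}"
proof -
  assume "3 \<le> k"
  then have "k = Suc (Suc (Suc (k - 3)))" by simp
  then obtain j where "k = Suc (Suc (Suc j))" ..
  moreover have "tab p = [Zero, One, Two, Three] \<longleftrightarrow> p = id" for p
    using tab_eq_iff[of p id] by (simp add: tab_def)
  ultimately show ?thesis by (auto simp: perms4_def)
qed

lemma perms4_bij: "p \<in> perms4 k \<Longrightarrow> bij p"
  using closed_commutators_in_der4[of k]
  by (auto simp: closed_commutators_in_def perms4_def list_all_iff tab_in_sym4[symmetric])

lemma perms4_comp: "p \<in> perms4 k \<Longrightarrow> q \<in> perms4 k \<Longrightarrow> p \<circ> q \<in> perms4 k"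
  using closed_commutators_in_der4[of k]
  by (auto simp: closed_commutators_in_def perms4_def list_all_iff tmult_tab[symmetric])

lemma tab_of_sym4: "l \<in> set sym4 \<Longrightarrow> \<exists>p. l = tab p"
  unfolding sym4_eq by blast

lemma der4_sym4: "l \<in> set (der4 k) \<Longrightarrow> l \<in> set sym4"
  using closed_commutators_in_der4[of k] by (auto simp: closed_commutators_in_def list_all_iff)

lemma perms4_inv: "p \<in> perms4 k \<Longrightarrow> Hilbert_Choice.inv p \<in> perms4 k"
proof -
  assume p: "p \<in> perms4 k"
  then obtain l where l: "l \<in> set (der4 k)" "tmult l (tab p) = [Zero, One, Two, Three]"
    using closed_commutators_in_der4[of k] by (auto simp: closed_commutators_in_def perms4_def list_all_iff list_ex_iff)
  obtain q where q: "l = tab q" using tab_of_sym4 der4_sym4 l(1) by blast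
  have "tab (q \<circ> p) = tab id" using l q by (simp add: tmult_tab) (simp add: tab_def)
  then have "q \<circ> p = id" by (simp add: tab_eq_iff)
  then have "Hilbert_Choice.inv p = q"
    using perms4_bij[OF p] by (metis bij_is_surj comp_assoc comp_id id_comp surj_iff)
  then show ?thesis using l q by (simp add: perms4_def)
qed

lemma perms4_id: "id \<in> perms4 k"
proof -
  have "Zero # [One, Two, Three] \<in> set (der4 k)"
    by (cases k rule: der4.cases) (simp_all add: sym4_def four_lists_def set_n_lists)
  then show ?thesis by (simp add: perms4_def tab_def)
qed

lemma perms4_commutator:
  assumes "p \<in> perms4 k" "q \<in> perms4 k"
  shows "p \<circ> q \<circ> Hilbert_Choice.inv p \<circ> Hilbert_Choice.inv q \<in> perms4 (Suc k)"
proof -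
  obtain l where l: "l \<in> set (der4 (Suc k))" "tab (p \<circ> q) = tmult l (tab (q \<circ> p))"
    using closed_commutators_in_der4[of k] assms
    unfolding closed_commutators_in_def perms4_def list_all_iff list_ex_iff mem_Collect_eq
    by (metis tmult_tab)
  obtain r where r: "l = tab r" using tab_of_sym4 der4_sym4 l(1) by blast
  have eq: "p \<circ> q = r \<circ> (q \<circ> p)" using l(2) by (simp add: r tmult_tab tab_eq_iff)
  have bij: "bij p" "bij q" using assms perms4_bij by auto
  have "p \<circ> q \<circ> Hilbert_Choice.inv p \<circ> Hilbert_Choice.inv q
      = r \<circ> ((q \<circ> p) \<circ> Hilbert_Choice.inv (q \<circ> p))"
    unfolding eq using bij by (simp add: o_inv_distrib o_assoc)
  also have "\<dots> = r"
    using surj_iff[of "q \<circ> p"] bij_is_surj[OF bij_comp[OF bij]] by simp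
  finally show ?thesis using l r by (simp add: perms4_def)
qed

section \<open>The iterated wreath product in product action\<close>

type_synonym point = "four \<Rightarrow> four \<Rightarrow> four"

text \<open>The entry of the image at \<open>(b, c)\<close> is read off at row
  \<open>\<rho> b\<close> and column \<open>\<pi> b c\<close>, then moved by its own
  \<open>\<sigma> b c\<close>. Since coordinates are pulled back, composition reverses the order of
  the \<open>\<rho>\<close> and \<open>\<pi>\<close> parts but not of the \<open>\<sigma>\<close>
  parts.\<close>

definition wr :: "(four \<Rightarrow> four) \<Rightarrow> (four \<Rightarrow> four \<Rightarrow> four) \<Rightarrow> (four \<Rightarrow> four \<Rightarrow> four \<Rightarrow> four) \<Rightarrow> point \<Rightarrow> point"
  where "wr \<rho> \<pi> \<sigma> x = (\<lambda>b c. \<sigma> b c (x (\<rho> b) (\<pi> b c)))"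

text \<open>The chain proving solubility descends through the outer, the middle and the inner \<open>S\<^sub>4\<close> in
  turn. Truncated subtraction makes \<^term>\<open>perms4 (k - 3)\<close> all of \<open>S\<^sub>4\<close> for \<open>k \<le> 3\<close>.\<close>

definition wr_chain :: "nat \<Rightarrow> (point \<Rightarrow> point) set"
  where "wr_chain k = {wr \<rho> \<pi> \<sigma> | \<rho> \<pi> \<sigma>.
    \<rho> \<in> perms4 k \<and> (\<forall>b. \<pi> b \<in> perms4 (k - 3)) \<and> (\<forall>b c. \<sigma> b c \<in> perms4 (k - 6))}"

abbreviation W :: "(point \<Rightarrow> point) set"
  where "W \<equiv> wr_chain 0"

lemma wr_in_W: "bij \<rho> \<Longrightarrow> (\<And>b. bij (\<pi> b)) \<Longrightarrow> (\<And>b c. bij (\<sigma> b c)) \<Longrightarrow> wr \<rho> \<pi> \<sigma> \<in> W"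
  by (auto simp: wr_chain_def perms4_0)

lemma W_cases:
  assumes "f \<in> W"
  obtains \<rho> \<pi> \<sigma> where "f = wr \<rho> \<pi> \<sigma>" "bij \<rho>" "\<And>b. bij (\<pi> b)" "\<And>b c. bij (\<sigma> b c)"
  using assms by (auto simp: wr_chain_def perms4_0)

lemma wr_comp:
  "wr \<rho> \<pi> \<sigma> \<circ> wr \<rho>' \<pi>' \<sigma>' = wr (\<rho>' \<circ> \<rho>) (\<lambda>b. \<pi>' (\<rho> b) \<circ> \<pi> b) (\<lambda>b c. \<sigma> b c \<circ> \<sigma>' (\<rho> b) (\<pi> b c))"
  by (simp add: wr_def fun_eq_iff)

lemma wr_id: "wr id (\<lambda>b. id) (\<lambda>b c. id) = id"
  by (simp add: wr_def fun_eq_iff)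

text \<open>The parameters of the inverse, found by setting the product in \<open>wr_comp\<close>
  equal to the identity and solving.\<close>

definition wr_inv_\<pi> where "wr_inv_\<pi> \<rho> \<pi> b = Hilbert_Choice.inv (\<pi> (Hilbert_Choice.inv \<rho> b))"

definition wr_inv_\<sigma> where
  "wr_inv_\<sigma> \<rho> \<pi> \<sigma> b c = Hilbert_Choice.inv (\<sigma> (Hilbert_Choice.inv \<rho> b) (wr_inv_\<pi> \<rho> \<pi> b c))"

lemma wr_inv:
  assumes "bij \<rho>" "\<And>b. bij (\<pi> b)" "\<And>b c. bij (\<sigma> b c)"
  shows "wr \<rho> \<pi> \<sigma> \<circ> wr (Hilbert_Choice.inv \<rho>) (wr_inv_\<pi> \<rho> \<pi>) (wr_inv_\<sigma> \<rho> \<pi> \<sigma>) = id" (is ?right)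
    and "wr (Hilbert_Choice.inv \<rho>) (wr_inv_\<pi> \<rho> \<pi>) (wr_inv_\<sigma> \<rho> \<pi> \<sigma>) \<circ> wr \<rho> \<pi> \<sigma> = id" (is ?left)
proof -
  have [simp]: "Hilbert_Choice.inv \<rho> (\<rho> b) = b" "\<rho> (Hilbert_Choice.inv \<rho> b) = b"
    "Hilbert_Choice.inv (\<pi> a) (\<pi> a b) = b" "\<pi> a (Hilbert_Choice.inv (\<pi> a) b) = b"
    "Hilbert_Choice.inv (\<sigma> a c) (\<sigma> a c b) = b" "\<sigma> a c (Hilbert_Choice.inv (\<sigma> a c) b) = b" for a b c
    using assms by (simp_all add: bij_is_inj bij_is_surj surj_f_inv_f)
  show ?right ?left
    by (simp_all add: wr_def wr_inv_\<pi>_def wr_inv_\<sigma>_def fun_eq_iff)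
qed

lemma perm_closed_wr_chain: "perm_closed (wr_chain k)"
  unfolding perm_closed_def
proof (intro conjI ballI)
  show "id \<in> wr_chain k"
    unfolding wr_chain_def using perms4_id wr_id by (intro CollectI exI) (auto intro: wr_id[symmetric])
next
  fix f h assume "f \<in> wr_chain k" "h \<in> wr_chain k"
  then show "f \<circ> h \<in> wr_chain k"
    unfolding wr_chain_def by (clarsimp simp: wr_comp) (metis (no_types, lifting) perms4_comp)
next
  fix f assume f: "f \<in> wr_chain k"
  then obtain \<rho> \<pi> \<sigma> where p: "f = wr \<rho> \<pi> \<sigma>" "\<rho> \<in> perms4 k" "\<And>b. \<pi> b \<in> perms4 (k - 3)"
    "\<And>b c. \<sigma> b c \<in> perms4 (k - 6)" by (auto simp: wr_chain_def)
  let ?f' = "wr (Hilbert_Choice.inv \<rho>) (wr_inv_\<pi> \<rho> \<pi>) (wr_inv_\<sigma> \<rho> \<pi> \<sigma>)"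
  have "f \<circ> ?f' = id" "?f' \<circ> f = id"
    unfolding p(1) using p perms4_bij by (blast intro: wr_inv)+
  then show "bij f" "Hilbert_Choice.inv f \<in> wr_chain k"
  proof -
    assume i: "f \<circ> ?f' = id" "?f' \<circ> f = id"
    then show "bij f" by (metis o_bij)
    have "Hilbert_Choice.inv f = ?f'" using i inv_unique_comp by blast
    moreover have "?f' \<in> wr_chain k"
      using p perms4_inv by (auto simp: wr_chain_def wr_inv_\<pi>_def wr_inv_\<sigma>_def intro!: exI)
    ultimately show "Hilbert_Choice.inv f \<in> wr_chain k" by simp
  qed
qed

text \<open>For \<open>k < 3\<close> only the outer part has to descend, the other two ranging over
  all of \<open>S_4\<close>. For \<open>3 \<le> k < 6\<close> the outer part is trivial, so the
  middle parts form commutators row by row. From \<open>k = 6\<close> on only the entrywise parts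
  remain.\<close>

lemma wr_chain_commutator:
  assumes "f \<in> wr_chain k" "h \<in> wr_chain k"
  shows "f \<circ> h \<circ> Hilbert_Choice.inv f \<circ> Hilbert_Choice.inv h \<in> wr_chain (Suc k)"
proof -
  obtain \<rho> \<pi> \<sigma> where f: "f = wr \<rho> \<pi> \<sigma>" "\<rho> \<in> perms4 k" "\<And>b. \<pi> b \<in> perms4 (k - 3)"
    "\<And>b c. \<sigma> b c \<in> perms4 (k - 6)" using assms by (auto simp: wr_chain_def)
  obtain \<rho>' \<pi>' \<sigma>' where h: "h = wr \<rho>' \<pi>' \<sigma>'" "\<rho>' \<in> perms4 k" "\<And>b. \<pi>' b \<in> perms4 (k - 3)"
    "\<And>b c. \<sigma>' b c \<in> perms4 (k - 6)" using assms by (auto simp: wr_chain_def)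
  note bij = f(2-)[THEN perms4_bij] h(2-)[THEN perms4_bij]
  have inv_f: "Hilbert_Choice.inv f = wr (Hilbert_Choice.inv \<rho>) (wr_inv_\<pi> \<rho> \<pi>) (wr_inv_\<sigma> \<rho> \<pi> \<sigma>)"
    unfolding f(1) by (intro inv_unique_comp wr_inv bij)
  have inv_h: "Hilbert_Choice.inv h = wr (Hilbert_Choice.inv \<rho>') (wr_inv_\<pi> \<rho>' \<pi>') (wr_inv_\<sigma> \<rho>' \<pi>' \<sigma>')"
    unfolding h(1) by (intro inv_unique_comp wr_inv bij)
  note params = perms4_comp perms4_inv f(2-) h(2-)
  \<comment> \<open>Because the order is reversed, the outer part of the commutator of
    \<open>f\<close> and \<open>h\<close> is the commutator of the inverses of
    \<open>\<rho>'\<close> and \<open>\<rho>\<close>.\<close>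
  have \<rho>: "Hilbert_Choice.inv \<rho>' \<circ> (Hilbert_Choice.inv \<rho> \<circ> (\<rho>' \<circ> \<rho>)) \<in> perms4 (Suc k)"
    using perms4_commutator[of "Hilbert_Choice.inv \<rho>'" k "Hilbert_Choice.inv \<rho>"] bij
    by (simp add: params inv_inv_eq o_assoc)
  consider "k < 3" | "3 \<le> k" "k < 6" | "6 \<le> k" by linarith
  then show ?thesis
  proof cases
    case 1
    then have *: "Suc k - 3 = k - 3" "Suc k - 6 = k - 6" by auto
    show ?thesis
      unfolding inv_f inv_h unfolding f(1) h(1) wr_comp wr_chain_def *
      by (intro CollectI exI conjI refl allI)
        (use \<rho> in \<open>auto simp: wr_inv_\<pi>_def wr_inv_\<sigma>_def intro!: params\<close>)
  next
    case 2
    then have id: "\<rho> = id" "\<rho>' = id" using f(2) h(2) by (auto simp: perms4_ge_3)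
    have *: "Suc k - 3 = Suc (k - 3)" "Suc k - 6 = k - 6" using 2 by auto
    have \<pi>: "wr_inv_\<pi> id \<pi>' b \<circ> (wr_inv_\<pi> id \<pi> b \<circ> (\<pi>' b \<circ> \<pi> b)) \<in> perms4 (Suc (k - 3))" for b
      using perms4_commutator[of "Hilbert_Choice.inv (\<pi>' b)" "k - 3" "Hilbert_Choice.inv (\<pi> b)"] bij
      by (simp add: params inv_inv_eq o_assoc wr_inv_\<pi>_def)
    show ?thesis
      unfolding inv_f inv_h unfolding f(1) h(1) wr_comp wr_chain_def *
      by (intro CollectI exI conjI refl allI, use \<rho> \<pi> in \<open>simp_all add: id\<close>)
        (auto simp: wr_inv_\<sigma>_def intro!: params)
  next
    case 3
    then have id: "\<rho> = id" "\<rho>' = id" "\<pi> = (\<lambda>b. id)" "\<pi>' = (\<lambda>b. id)"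
      using f(2,3) h(2,3) by (auto simp: perms4_ge_3)
    have *: "Suc k - 3 = Suc (k - 3)" "Suc k - 6 = Suc (k - 6)" using 3 by auto
    have i: "perms4 (Suc (k - 3)) = {id}" using 3 by (simp add: perms4_ge_3)
    have "\<sigma> b c \<circ> \<sigma>' b c \<circ> wr_inv_\<sigma> id (\<lambda>b. id) \<sigma> b c \<circ> wr_inv_\<sigma> id (\<lambda>b. id) \<sigma>' b c \<in> perms4 (Suc (k - 6))" for b c
      using perms4_commutator[of "\<sigma> b c" "k - 6" "\<sigma>' b c"]
      by (simp add: params wr_inv_\<sigma>_def wr_inv_\<pi>_def)
    then show ?thesis
      unfolding inv_f inv_h unfolding f(1) h(1) wr_comp wr_chain_def *
      by (intro CollectI exI conjI refl allI)
        (use \<rho> in \<open>auto simp: id i wr_inv_\<pi>_def\<close>)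
  qed
qed

text \<open>Each of the three factors \<open>S_4\<close> has derived length 3, which makes nine
  steps.\<close>

lemma wr_chain_9: "wr_chain 9 = {id}"
proof -
  have "wr id \<pi> \<sigma> = id" if "\<forall>b. \<pi> b = id" "\<forall>b c. \<sigma> b c = id" for \<pi> \<sigma>
    using that by (simp add: wr_def fun_eq_iff)
  then show ?thesis
    using perm_closed_wr_chain[of 9] by (auto simp: wr_chain_def perms4_ge_3 perm_closed_def)
qed

section \<open>Transitivity and primitivity of the wreath product\<close>

lemma W_transitive: "\<exists>f\<in>W. f x = y"
proof
  show "wr id (\<lambda>b. id) (\<lambda>b c. transpose (x b c) (y b c)) \<in> W" by (rule wr_in_W) auto
  show "wr id (\<lambda>b. id) (\<lambda>b c. transpose (x b c) (y b c)) x = y" by (simp add: wr_def)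
qed

definition change :: "four \<Rightarrow> four \<Rightarrow> four \<Rightarrow> point \<Rightarrow> point"
  where "change b c a x = x(b := (x b)(c := a))"

lemma change_in_W:
  assumes "bij s"
  shows "\<exists>f\<in>W. \<forall>z. f z = change b c (s (z b c)) z"
proof
  let ?f = "wr id (\<lambda>b. id) (\<lambda>b' c'. if b' = b \<and> c' = c then s else id)"
  show "?f \<in> W" using assms by (intro wr_in_W) auto
  show "\<forall>z. ?f z = change b c (s (z b c)) z" by (auto simp: wr_def change_def fun_eq_iff)
qed

text \<open>Two points of a block that differ in one coordinate allow that coordinate of one of them
  to be changed freely within the block. Transitivity on points and coordinates then allows any
  coordinate of any block point to be changed, and finitely many changes reach every array.\<close>

lemma W_primitive:
  assumes x: "x \<in> B" and y: "y \<in> B" and "x \<noteq> y"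
    and block: "\<And>f. f \<in> W \<Longrightarrow> f ` B = B \<or> f ` B \<inter> B = {}"
  shows "B = UNIV"
proof -
  have move: "f q \<in> B" if "f \<in> W" "p \<in> B" "f p \<in> B" "q \<in> B" for f p q
  proof -
    have "f ` B = B" using block[OF that(1)] that(2,3) by blast
    with that(4) show ?thesis by (metis imageI)
  qed
  obtain b c where bc: "x b c \<noteq> y b c" using \<open>x \<noteq> y\<close> by (auto simp: fun_eq_iff)
  \<comment> \<open>A third value exists as there are four. Swapping it with \<open>y b c\<close> at
    this coordinate fixes \<open>x\<close> but moves \<open>y\<close>.\<close>
  obtain a where a: "a \<noteq> x b c" "a \<noteq> y b c"
  proof -
    have "card {x b c, y b c} < card (UNIV :: four set)" using bc by (simp add: UNIV_four)
    then have "{x b c, y b c} \<noteq> UNIV" by force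
    then show ?thesis using that by blast
  qed
  have ya: "change b c a y \<in> B"
  proof -
    obtain f where f: "f \<in> W" "\<And>z. f z = change b c (transpose (y b c) a (z b c)) z"
      using change_in_W[of "transpose (y b c) a" b c] by auto
    have "f x = x" using a bc by (simp add: f(2) change_def)
    then have "f y \<in> B" using move[OF f(1) x _ y] x by simp
    then show ?thesis by (simp add: f(2))
  qed
  have yc: "change b c a' y \<in> B" for a'
  proof (cases "a' = y b c")
    case True
    then show ?thesis using y by (simp add: change_def)
  next
    case False
    obtain f where f: "f \<in> W" "\<And>z. f z = change b c (transpose a a' (z b c)) z"
      using change_in_W[of "transpose a a'" b c] by auto
    \<comment> \<open>The block now contains \<open>y\<close> and its variant with entry
      \<open>a\<close>. Swapping \<open>a\<close> and \<open>a'\<close> fixes \<open>y\<close> and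
      turns the variant into the one with entry \<open>a'\<close>.\<close>
    have "f y = y" using a False by (simp add: f(2) change_def)
    then have "f (change b c a y) \<in> B" using move[OF f(1) y _ ya] y by simp
    then show ?thesis by (simp add: f(2) change_def)
  qed
  have step: "change b' c' a' z \<in> B" if z: "z \<in> B" for z b' c' a'
  proof -
    \<comment> \<open>The values are chosen so that \<open>f\<close> sends \<open>y\<close> to
      \<open>z\<close>, while position \<open>(b', c')\<close> of the image is read off at
      \<open>(b, c)\<close>. Changes of \<open>y\<close> at the latter thus become changes of
      \<open>z\<close> at the former.\<close>
    define \<sigma> where "\<sigma> p q = transpose (y (transpose b b' p) (transpose c c' q)) (z p q)" for p q
    define f where "f = wr (transpose b b') (\<lambda>_. transpose c c') \<sigma>"
    have f: "f \<in> W" unfolding f_def by (rule wr_in_W) (simp_all add: \<sigma>_def)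
    have fy: "f y = z" by (simp add: f_def wr_def \<sigma>_def)
    obtain s where s: "\<sigma> b' c' s = a'" by (metis \<sigma>_def transpose_involutory)
    have "f (change b c s y) = change b' c' a' z"
    proof (intro ext)
      fix p q
      have "transpose b b' p = b \<longleftrightarrow> p = b'" "transpose c c' q = c \<longleftrightarrow> q = c'"
        by (metis transpose_apply_second transpose_involutory)+
      then show "f (change b c s y) p q = change b' c' a' z p q"
        using s by (auto simp: f_def wr_def change_def) (auto simp: \<sigma>_def)
    qed
    then show ?thesis using move[OF f y _ yc[of s]] fy z by simp
  qed
  have "(\<lambda>b c. if (b, c) \<in> A then q b c else y b c) \<in> B" for A q
    using finite[of A]
  proof (induction A rule: finite_induct)
    case empty
    then show ?case using y by simp
  next
    case (insert p A)
    obtain b' c' where p: "p = (b', c')" by force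
    have "(\<lambda>b c. if (b, c) \<in> insert p A then q b c else y b c)
        = change b' c' (q b' c') (\<lambda>b c. if (b, c) \<in> A then q b c else y b c)"
      by (auto simp: p change_def fun_eq_iff)
    with step[OF insert.IH] show ?case by simp
  qed
  from this[of UNIV] show ?thesis by auto
qed

section \<open>The first two greedy steps\<close>

definition zeros :: "(four \<Rightarrow> four) \<Rightarrow> nat"
  where "zeros r = card {c. r c = Zero}"

definition origin :: point
  where "origin = (\<lambda>b c. Zero)"

definition zero_class :: "(four \<Rightarrow> nat) \<Rightarrow> point set"
  where "zero_class \<zeta> = {y. \<exists>\<rho>. bij \<rho> \<and> (\<forall>b. zeros (y b) = \<zeta> (\<rho> b))}"

lemma zeros_permute: "bij p \<Longrightarrow> zeros (r \<circ> p) = zeros r"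
proof -
  assume p: "bij p"
  have "{c. r (p c) = Zero} = p -` {c. r c = Zero}" by auto
  moreover have "card (p -` {c. r c = Zero}) = card {c. r c = Zero}"
    using p by (intro card_vimage_inj) (simp_all add: bij_is_inj bij_is_surj)
  ultimately show ?thesis by (simp add: zeros_def)
qed

text \<open>A bijection between the zero positions is glued to one between the complements, which
  also have equal size.\<close>

lemma zeros_eq_obtain_perm:
  assumes "zeros r = zeros s"
  obtains p where "bij p" "\<And>c. r c = Zero \<longleftrightarrow> s (p c) = Zero"
proof -
  let ?A = "{c. r c = Zero}" and ?B = "{c. s c = Zero}"
  have eq: "card ?A = card ?B" using assms by (simp add: zeros_def)
  then obtain f where f: "bij_betw f ?A ?B" by (meson finite finite_same_card_bij)
  have "card (- ?A) = card (- ?B)" using eq by (simp add: Compl_eq_Diff_UNIV card_Diff_subset)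
  then obtain g where g: "bij_betw g (- ?A) (- ?B)" by (meson finite finite_same_card_bij)
  define p where "p c = (if c \<in> ?A then f c else g c)" for c
  have "bij p" using bij_betw_disjoint_Un[OF f g] by (simp add: p_def[abs_def])
  moreover have "r c = Zero \<longleftrightarrow> s (p c) = Zero" for c
    using bij_betwE[OF f] bij_betwE[OF g] by (auto simp: p_def)
  ultimately show ?thesis using that by blast
qed

text \<open>Fixing the zero array means that every entrywise permutation fixes \<open>Zero\<close>,
  so zeros are only moved around by the row and column permutations. Conversely, rows are matched by
  \<open>\<rho>\<close>, zeros within rows by \<open>\<pi>\<close>, and the nonzero values by
  transpositions.\<close>

lemma orb_fixer_origin: "orb (fixer W {origin}) x = zero_class (\<lambda>b. zeros (x b))"
proof (intro equalityI subsetI)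
  fix y assume "y \<in> orb (fixer W {origin}) x"
  then obtain f where f: "f \<in> W" "f origin = origin" "y = f x" by (auto simp: orb_def fixer_def)
  then obtain \<rho> \<pi> \<sigma> where p: "f = wr \<rho> \<pi> \<sigma>" "bij \<rho>" "\<And>b. bij (\<pi> b)" "\<And>b c. bij (\<sigma> b c)"
    using W_cases by blast
  have 0: "\<sigma> b c Zero = Zero" for b c
    using fun_cong[OF fun_cong[OF f(2)], of b c] by (simp add: p(1) wr_def origin_def)
  have "\<sigma> b c a = Zero \<longleftrightarrow> a = Zero" for a b c by (metis 0 p(4) bij_is_inj injD)
  then have "zeros (y b) = zeros (x (\<rho> b) \<circ> \<pi> b)" for b by (simp add: f(3) p(1) wr_def zeros_def)
  then have "zeros (y b) = zeros (x (\<rho> b))" for b using zeros_permute[OF p(3)] by simp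
  with p(2) show "y \<in> zero_class (\<lambda>b. zeros (x b))" by (auto simp: zero_class_def)
next
  fix y assume "y \<in> zero_class (\<lambda>b. zeros (x b))"
  then obtain \<rho> where \<rho>: "bij \<rho>" "\<And>b. zeros (y b) = zeros (x (\<rho> b))" by (auto simp: zero_class_def)
  have "\<exists>p. bij p \<and> (\<forall>c. y b c = Zero \<longleftrightarrow> x (\<rho> b) (p c) = Zero)" for b
    using \<rho>(2)[of b] zeros_eq_obtain_perm by metis
  then obtain \<pi> where \<pi>: "\<And>b. bij (\<pi> b)" "\<And>b c. y b c = Zero \<longleftrightarrow> x (\<rho> b) (\<pi> b c) = Zero" by metis
  let ?f = "wr \<rho> \<pi> (\<lambda>b c. transpose (x (\<rho> b) (\<pi> b c)) (y b c))"
  have "?f \<in> W" using \<rho>(1) \<pi>(1) by (intro wr_in_W) auto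
  \<comment> \<open>After matching, each transposition exchanges either two nonzero values or
    \<open>Zero\<close> with itself.\<close>
  moreover have "transpose (x (\<rho> b) (\<pi> b c)) (y b c) Zero = Zero" for b c
    using \<pi>(2)[of b c] by (cases "y b c = Zero") (simp_all add: transpose_def)
  then have "?f origin = origin" by (simp add: wr_def origin_def)
  moreover have "?f x = y" by (simp add: wr_def)
  ultimately show "y \<in> orb (fixer W {origin}) x"
    unfolding orb_def fixer_def by (intro image_eqI[of _ _ ?f]) simp_all
qed

section \<open>Sizes of the orbits of the stabiliser of the zero array\<close>

definition rows_with :: "nat \<Rightarrow> nat"
  where "rows_with z = card {r. zeros r = z}"

lemma zeros_tab: "zeros r = length (filter ((=) Zero) (tab r))"
proof -
  let ?l = "[Zero, One, Two, Three]"
  have "c \<in> {c. r c = Zero} \<longleftrightarrow> c \<in> set (filter (\<lambda>c. r c = Zero) ?l)" for c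
    by (cases c) simp_all
  then have "{c. r c = Zero} = set (filter (\<lambda>c. r c = Zero) ?l)" by blast
  moreover have "distinct (filter (\<lambda>c. r c = Zero) ?l)" by (intro distinct_filter) simp
  ultimately have "zeros r = length (filter (\<lambda>c. r c = Zero) ?l)"
    unfolding zeros_def by (simp only: distinct_card)
  also have "\<dots> = length (filter ((=) Zero) (tab r))" unfolding tab_def by (simp add: eq_commute[of Zero])
  finally show ?thesis .
qed

lemma rows_with_code:
  "rows_with z = length (filter (\<lambda>l. length (filter ((=) Zero) l) = z) four_lists)"
proof -
  have "rows_with z = card (tab ` {r. zeros r = z})"
    unfolding rows_with_def by (rule card_image[symmetric]) (simp add: inj_on_def tab_eq_iff)
  also have "tab ` {r. zeros r = z} = set (filter (\<lambda>l. length (filter ((=) Zero) l) = z) four_lists)"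
    using range_tab by (auto simp: zeros_tab)
  finally show ?thesis
    by (simp only: distinct_card[OF distinct_filter[OF distinct_four_lists]])
qed

lemma rows_with_values:
  "rows_with 0 = 81" "rows_with 1 = 108" "rows_with 2 = 54" "rows_with 3 = 12" "rows_with 4 = 1"
  unfolding rows_with_code by code_simp+

definition arrangements :: "(four \<Rightarrow> nat) \<Rightarrow> (four \<Rightarrow> nat) set"
  where "arrangements \<zeta> = (\<lambda>\<rho>. \<zeta> \<circ> \<rho>) ` {\<rho>. bij \<rho>}"

lemma card_arrangements: "card (arrangements \<zeta>) = length (remdups (map (map \<zeta>) sym4))"
proof -
  have "card (arrangements \<zeta>) = card (tab ` arrangements \<zeta>)"
    by (rule card_image[symmetric]) (simp add: inj_on_def tab_eq_iff)
  also have "tab ` arrangements \<zeta> = map \<zeta> ` set sym4"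
    by (simp add: arrangements_def sym4_eq image_image tab_comp)
  finally show ?thesis by (simp add: length_remdups_card_conv)
qed

text \<open>The class splits disjointly according to which row has how many zeros. Each piece is a
  product of row classes, and rearranging the factors does not alter its size.\<close>

lemma card_zero_class: "card (zero_class \<zeta>) = card (arrangements \<zeta>) * (\<Prod>b\<in>UNIV. rows_with (\<zeta> b))"
proof -
  have rows: "card {y. \<forall>b. zeros (y b) = \<eta> b} = (\<Prod>b\<in>UNIV. rows_with (\<eta> b))"
    for \<eta> :: "four \<Rightarrow> nat"
  proof -
    have "{y. \<forall>b. zeros (y b) = \<eta> b} = PiE UNIV (\<lambda>b. {r. zeros r = \<eta> b})"
      by (auto simp: PiE_def Pi_def)
    then show ?thesis by (simp only: card_PiE[OF finite] rows_with_def)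
  qed
  have perm: "(\<Prod>b\<in>UNIV. rows_with (\<eta> b)) = (\<Prod>b\<in>UNIV. rows_with (\<zeta> b))"
    if "\<eta> \<in> arrangements \<zeta>" for \<eta>
    using that prod.reindex_bij_betw[of _ UNIV UNIV "\<lambda>b. rows_with (\<zeta> b)"]
    by (auto simp: arrangements_def)
  have "zero_class \<zeta> = (\<Union>\<eta>\<in>arrangements \<zeta>. {y. \<forall>b. zeros (y b) = \<eta> b})"
    by (auto simp: zero_class_def arrangements_def)
  then have "card (zero_class \<zeta>) = (\<Sum>\<eta>\<in>arrangements \<zeta>. card {y. \<forall>b. zeros (y b) = \<eta> b})"
    by (simp only:) (rule card_UN_disjoint, auto simp: fun_eq_iff arrangements_def)
  also have "\<dots> = (\<Sum>\<eta>\<in>arrangements \<zeta>. \<Prod>b\<in>UNIV. rows_with (\<zeta> b))"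
    unfolding rows by (rule sum.cong[OF refl perm])
  finally show ?thesis by simp
qed

text \<open>The executable form of \<open>card_zero_class\<close> on tables; the constants are the
  values of \<open>rows_with\<close> at 0 to 4.\<close>

definition class_size :: "nat list \<Rightarrow> int"
  where "class_size l = int (length (remdups (map (map (untab l)) sym4))) *
    prod_list (map (\<lambda>z. [81, 108, 54, 12, 1] ! z) l)"

lemma class_size_le:
  "list_all (\<lambda>l. class_size l \<le> class_size [2, 0, 1, 1]) (List.n_lists 4 [0, 1, 2, 3, 4])"
proof -
  \<comment> \<open>This is 12 arrangements times \<open>54 * 81 * 108 * 108\<close>. The even
    pattern \<open>1, 1, 1, 1\<close> has larger row classes, but only one arrangement.\<close>
  have "class_size [2, 0, 1, 1] = 612220032" by code_simp
  moreover have "list_all (\<lambda>l. class_size l \<le> 612220032) (List.n_lists 4 [0, 1, 2, 3, 4])" by code_simp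
  ultimately show ?thesis by simp
qed

lemma card_zero_class_eq_class_size:
  assumes "\<And>b. \<zeta> b \<le> 4"
  shows "int (card (zero_class \<zeta>)) = class_size (tab \<zeta>)"
proof -
  have "int (rows_with z) = [81, 108, 54, 12, 1] ! z" if "z \<le> 4" for z
  proof -
    from that consider "z = 0" | "z = 1" | "z = 2" | "z = 3" | "z = 4" by linarith
    then show ?thesis by cases (simp_all add: rows_with_values rows_with_values(2)[simplified])
  qed
  then have "(\<Prod>b\<in>UNIV. int (rows_with (\<zeta> b))) = (\<Prod>b\<in>UNIV. [81, 108, 54, 12, 1] ! \<zeta> b)"
    using assms by simp
  also have "\<dots> = prod_list (map (\<lambda>z. [81, 108, 54, 12, 1] ! z) (tab \<zeta>))"
    by (simp add: UNIV_four tab_def del: nth_Cons_numeral)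
  finally show ?thesis
    by (simp add: card_zero_class class_size_def card_arrangements)
qed

lemma zeros_le_4: "zeros r \<le> 4"
  unfolding zeros_tab by (rule order_trans[OF length_filter_le]) (simp add: tab_def)

text \<open>A representative of the pattern \<open>2, 0, 1, 1\<close> whose only row with two zeros
  is row \<open>Zero\<close>, with these zeros in columns \<open>Zero\<close> and
  \<open>One\<close>.\<close>

definition start :: point
  where "start = untab
    [untab [Zero, Zero, One, One], untab [One, One, One, One],
     untab [Zero, One, One, One], untab [Zero, One, One, One]]"

lemma zeros_start: "zeros (start Zero) = 2" "b \<noteq> Zero \<Longrightarrow> zeros (start b) < 2"
  by (cases b; simp add: start_def zeros_tab tab_def)+

lemma start_longest:
  "card (orb (fixer W {origin}) y) \<le> card (orb (fixer W {origin}) start)"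
proof -
  have tab_start: "tab (\<lambda>b. zeros (start b)) = [2, 0, 1, 1]"
    by (simp add: tab_def zeros_tab start_def)
  have "tab (\<lambda>b. zeros (y b)) \<in> set (List.n_lists 4 [0, 1, 2, 3, 4])"
  proof -
    have "zeros r \<in> {0, 1, 2, 3, 4}" for r
      using zeros_le_4[of r] by (auto simp: numeral_eq_Suc le_Suc_eq)
    then show ?thesis by (simp add: set_n_lists tab_def)
  qed
  then have "class_size (tab (\<lambda>b. zeros (y b))) \<le> class_size (tab (\<lambda>b. zeros (start b)))"
    using class_size_le unfolding tab_start list_all_iff by blast
  then show ?thesis
    unfolding orb_fixer_origin by (simp add: card_zero_class_eq_class_size[symmetric] zeros_le_4)
qed

section \<open>Splitting off a pair of coordinates\<close>

definition on_pair :: "four \<Rightarrow> four \<Rightarrow> bool"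
  where "on_pair b c \<longleftrightarrow> b = Zero \<and> (c = Zero \<or> c = One)"

definition pair_part :: "point \<Rightarrow> four \<times> four"
  where "pair_part x = (x Zero Zero, x Zero One)"

definition rest_part :: "point \<Rightarrow> point"
  where "rest_part x = (\<lambda>b c. if on_pair b c then Zero else x b c)"

lemma point_eqI: "pair_part x = pair_part y \<Longrightarrow> rest_part x = rest_part y \<Longrightarrow> x = y"
  by (auto simp: pair_part_def rest_part_def on_pair_def fun_eq_iff split: if_splits)

lemma start_zero_pair: "start Zero c = Zero \<longleftrightarrow> on_pair Zero c"
  by (cases c) (simp_all add: start_def on_pair_def)

text \<open>Entrywise permutations fix \<open>Zero\<close>, so the zeros of \<open>start\<close> are
  preserved. Row \<open>Zero\<close> is the only one with two zeros, hence it is fixed by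
  \<open>\<rho>\<close> and its pair of zeros is preserved by \<open>\<pi> Zero\<close>.\<close>

lemma fixer_start_cases:
  assumes "f \<in> fixer W Q" "origin \<in> Q" "start \<in> Q"
  obtains \<rho> \<pi> \<sigma> where "f = wr \<rho> \<pi> \<sigma>" "bij \<rho>" "\<And>b. bij (\<pi> b)" "\<And>b c. bij (\<sigma> b c)"
    "\<rho> Zero = Zero" "\<And>b c. on_pair (\<rho> b) (\<pi> b c) \<longleftrightarrow> on_pair b c"
proof -
  have f: "f \<in> W" "f origin = origin" "f start = start" using assms by (auto simp: fixer_def)
  obtain \<rho> \<pi> \<sigma> where p: "f = wr \<rho> \<pi> \<sigma>" "bij \<rho>" "\<And>b. bij (\<pi> b)" "\<And>b c. bij (\<sigma> b c)"
    using W_cases[OF f(1)] by blast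
  have 0: "\<sigma> b c Zero = Zero" for b c
    using fun_cong[OF fun_cong[OF f(2)], of b c] by (simp add: p(1) wr_def origin_def)
  have \<sigma>: "\<sigma> b c a = Zero \<longleftrightarrow> a = Zero" for a b c by (metis 0 p(4) bij_is_inj injD)
  have st: "start b c = \<sigma> b c (start (\<rho> b) (\<pi> b c))" for b c
    using fun_cong[OF fun_cong[OF f(3)], of b c] by (simp add: p(1) wr_def)
  have zero: "start b c = Zero \<longleftrightarrow> start (\<rho> b) (\<pi> b c) = Zero" for b c
    using st[of b c] \<sigma> by metis
  have "zeros (start b) = zeros (start (\<rho> b) \<circ> \<pi> b)" for b
    by (simp add: zeros_def zero[of b])
  then have "zeros (start Zero) = zeros (start (\<rho> Zero))" using zeros_permute[OF p(3)] by metis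
  then have \<rho>: "\<rho> Zero = Zero" using zeros_start by fastforce
  then have "\<rho> b = Zero \<longleftrightarrow> b = Zero" for b using p(2) by (metis bij_is_inj injD)
  moreover have "on_pair Zero (\<pi> Zero c) \<longleftrightarrow> on_pair Zero c" for c
    using zero[of Zero c] by (simp add: \<rho> start_zero_pair)
  ultimately have "on_pair (\<rho> b) (\<pi> b c) \<longleftrightarrow> on_pair b c" for b c
    by (cases "b = Zero") (auto simp: on_pair_def)
  then show ?thesis using that p \<rho> by blast
qed

text \<open>If all points fixed so far are constant on the pair, then the stabiliser acts on the pair and
  on the remaining coordinates independently, on the pair as \<open>Sym M wr S\<^sub>2\<close> with \<open>M\<close> the set of values
  not yet used there. So a longest orbit may be chosen to start at a point constant on the pair.\<close>

lemma longest_constant_on_pair: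
  assumes Q: "origin \<in> Q" "start \<in> Q"
    and const: "\<And>q. q \<in> Q \<Longrightarrow> q Zero Zero = q Zero One"
    and M: "M = - ((\<lambda>q. q Zero Zero) ` Q)" "m \<in> M" "2 \<le> card M"
  shows "\<exists>x. x Zero Zero = m \<and> x Zero One = m \<and>
    (\<forall>y. card (orb (fixer W Q) y) \<le> card (orb (fixer W Q) x))"
proof -
  let ?S = "fixer W Q"
  \<comment> \<open>The projection of an orbit to the coordinates off the pair; it depends only on
    the starting values there.\<close>
  define R where "R y = rest_part ` orb ?S y" for y
  have R_cong: "R y = R y'" if rest: "rest_part y = rest_part y'" for y y'
  proof -
    have "rest_part (f y) = rest_part (f y')" if f: "f \<in> ?S" for f
    proof -
      obtain \<rho> \<pi> \<sigma> where p: "f = wr \<rho> \<pi> \<sigma>" "\<And>b c. on_pair (\<rho> b) (\<pi> b c) \<longleftrightarrow> on_pair b c"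
        using fixer_start_cases[OF f Q] by metis
      have "y b c = y' b c" if "\<not> on_pair b c" for b c
        using fun_cong[OF fun_cong[OF rest], of b c] that by (simp add: rest_part_def)
      then show ?thesis using p(2) by (auto simp: p(1) rest_part_def wr_def fun_eq_iff)
    qed
    then show ?thesis unfolding R_def orb_def image_image by (rule image_cong[OF refl])
  qed
  obtain y0 where y0: "\<And>y. card (R y) \<le> card (R y0)"
  proof -
    have "Max (range (\<lambda>y. card (R y))) \<in> range (\<lambda>y. card (R y))" by (intro Max_in) auto
    then obtain y0 where y0: "Max (range (\<lambda>y. card (R y))) = card (R y0)" by (rule rangeE)
    have "card (R y) \<le> card (R y0)" for y unfolding y0[symmetric] by (intro Max_ge) auto
    then show ?thesis by (rule that)
  qed
  define x where "x b c = (if on_pair b c then m else y0 b c)" for b c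
  have x_pair: "x Zero Zero = m" "x Zero One = m" by (simp_all add: x_def on_pair_def)
  have Rx: "R x = R y0" by (rule R_cong) (simp add: rest_part_def x_def fun_eq_iff)
  let ?split = "\<lambda>y. (pair_part y, rest_part y)"
  have inj: "inj ?split" by (auto intro!: injI point_eqI)
  have split: "card (orb ?S y) = card (?split ` orb ?S y)" for y
    using inj by (simp add: card_image inj_on_subset)
  have upper: "card (orb ?S y) \<le> card M * card M * card (R y)" for y
  proof -
    define st where "st a = (if a \<in> M then M else {a})" for a
    let ?a = "st (y Zero Zero)" and ?b = "st (y Zero One)"
    have "pair_part (f y) \<in> ?a \<times> ?b \<union> ?b \<times> ?a" if f: "f \<in> ?S" for f
    proof -
      obtain \<rho> \<pi> \<sigma> where p: "f = wr \<rho> \<pi> \<sigma>" "\<And>b. bij (\<pi> b)" "\<And>b c. bij (\<sigma> b c)"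
        "\<rho> Zero = Zero" "\<And>b c. on_pair (\<rho> b) (\<pi> b c) \<longleftrightarrow> on_pair b c"
        using fixer_start_cases[OF f Q] by metis
      have \<pi>: "\<pi> Zero c = Zero \<or> \<pi> Zero c = One" if "c = Zero \<or> c = One" for c
        using p(5)[of Zero c] that by (auto simp: p(4) on_pair_def)
      have "\<pi> Zero Zero \<noteq> \<pi> Zero One" using p(2) by (metis bij_is_inj injD four.distinct(1))
      with \<pi> have cases: "\<pi> Zero Zero = Zero \<and> \<pi> Zero One = One \<or> \<pi> Zero Zero = One \<and> \<pi> Zero One = Zero"
        by metis
      \<comment> \<open>A used value \<open>k\<close> occurs at both coordinates of the pair in some
        fixed point \<open>q\<close>, so it must be fixed whether or not the two coordinates are
        exchanged.\<close>
      have fixed: "\<sigma> Zero c k = k" if k: "k \<notin> M" and c: "c = Zero \<or> c = One" for k c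
      proof -
        obtain q where q: "q \<in> Q" "k = q Zero Zero" using k by (auto simp: M(1))
        then have "f q = q" using f by (simp add: fixer_def)
        from fun_cong[OF fun_cong[OF this], of Zero c] show ?thesis
          using \<pi>[OF c] c const[OF q(1)] q(2) by (auto simp: p(1,4) wr_def)
      qed
      have "\<sigma> Zero c a \<in> st a" if c: "c = Zero \<or> c = One" for a c
      proof (cases "a \<in> M")
        case True
        have "\<sigma> Zero c a \<in> M"
        proof (rule ccontr)
          assume "\<sigma> Zero c a \<notin> M"
          with fixed[OF this c] p(3) have "\<sigma> Zero c a = a" by (metis bij_is_inj injD)
          with True \<open>\<sigma> Zero c a \<notin> M\<close> show False by simp
        qed
        with True show ?thesis by (simp add: st_def)
      qed (use fixed c in \<open>simp add: st_def\<close>)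
      with cases show ?thesis by (auto simp: pair_part_def p(1,4) wr_def)
    qed
    then have "?split ` orb ?S y \<subseteq> (?a \<times> ?b \<union> ?b \<times> ?a) \<times> R y"
      unfolding orb_def R_def image_image by (intro image_subsetI SigmaI imageI)
    then have "card (orb ?S y) \<le> card ((?a \<times> ?b \<union> ?b \<times> ?a) \<times> R y)"
      unfolding split by (rule card_mono[rotated]) simp
    also have "\<dots> = card (?a \<times> ?b \<union> ?b \<times> ?a) * card (R y)" by (rule card_cartesian_product)
    also have "card (?a \<times> ?b \<union> ?b \<times> ?a) \<le> card M * card M"
    proof (cases "y Zero Zero \<in> M \<and> y Zero One \<in> M")
      case True
      then show ?thesis by (simp add: st_def card_cartesian_product)
    next
      case False
      \<comment> \<open>Now one of the two factors is a singleton, so the union has at most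
        \<open>2 * card M\<close> elements; the bound \<open>2 \<le> card M\<close> enters
        here.\<close>
      have "card (?a \<times> ?b \<union> ?b \<times> ?a) \<le> card ?a * card ?b + card ?b * card ?a"
        by (metis card_Un_le card_cartesian_product)
      also have "\<dots> \<le> 2 * card M" using False M(3) by (auto simp: st_def)
      also have "\<dots> \<le> card M * card M" using M(3) by (rule mult_le_mono1)
      finally show ?thesis .
    qed
    finally show ?thesis by simp
  qed
  have lower: "card M * card M * card (R x) \<le> card (orb ?S x)"
  proof -
    have "(M \<times> M) \<times> R x \<subseteq> ?split ` orb ?S x"
    proof safe
      fix a b r assume ab: "a \<in> M" "b \<in> M" and "r \<in> R x"
      then obtain f where f: "f \<in> ?S" "r = rest_part (f x)" by (auto simp: R_def orb_def)
      obtain \<rho> \<pi> \<sigma> where p: "f = wr \<rho> \<pi> \<sigma>" "bij \<rho>" "\<And>b. bij (\<pi> b)" "\<And>b c. bij (\<sigma> b c)"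
        "\<rho> Zero = Zero" "\<And>b c. on_pair (\<rho> b) (\<pi> b c) \<longleftrightarrow> on_pair b c"
        using fixer_start_cases[OF f(1) Q] by blast
      \<comment> \<open>The values on the pair are redirected from \<open>m\<close> to
        \<open>a\<close> and \<open>b\<close>, with \<open>f\<close> kept elsewhere. Every point of
        \<open>Q\<close> stays fixed, as its value on the pair lies outside \<open>M\<close> and the
        transpositions move only elements of \<open>M\<close>.\<close>
      define \<sigma>' where "\<sigma>' b' c = (if on_pair b' c then transpose m (if c = Zero then a else b) else \<sigma> b' c)" for b' c
      let ?h = "wr \<rho> \<pi> \<sigma>'"
      have "?h \<in> W" using p by (intro wr_in_W) (auto simp: \<sigma>'_def)
      have pi: "\<pi> Zero c = Zero \<or> \<pi> Zero c = One" if "c = Zero \<or> c = One" for c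
        using p(6)[of Zero c] that by (auto simp: p(5) on_pair_def)
      have "?h q = q" if q: "q \<in> Q" for q
      proof (intro ext)
        fix b' c
        have fq: "f q = q" using f(1) q by (simp add: fixer_def)
        show "?h q b' c = q b' c"
        proof (cases "on_pair b' c")
          case False
          with fun_cong[OF fun_cong[OF fq], of b' c] show ?thesis by (simp add: p(1) wr_def \<sigma>'_def)
        next
          case True
          then have bc: "b' = Zero" "c = Zero \<or> c = One" by (auto simp: on_pair_def)
          have "q Zero Zero \<notin> M" using q M(1) by auto
          then have "q Zero Zero \<noteq> m" "q Zero Zero \<noteq> a" "q Zero Zero \<noteq> b" using ab M(2) by auto
          with bc pi[OF bc(2)] const[OF q] True show ?thesis
            by (auto simp: wr_def \<sigma>'_def p(5))
        qed
      qed
      with \<open>?h \<in> W\<close> have "?h \<in> ?S" by (simp add: fixer_def)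
      have "x Zero (\<pi> Zero Zero) = m" "x Zero (\<pi> Zero One) = m"
        using pi[of Zero] pi[of One] x_pair by metis+
      then have "pair_part (?h x) = (a, b)"
        by (simp add: pair_part_def wr_def \<sigma>'_def p(5) on_pair_def)
      moreover have "rest_part (?h x) = r"
        by (auto simp: f(2) p(1) rest_part_def wr_def \<sigma>'_def fun_eq_iff)
      ultimately show "((a, b), r) \<in> ?split ` orb ?S x"
        using \<open>?h \<in> ?S\<close> unfolding orb_def by (intro image_eqI[of _ _ "?h x"]) auto
    qed
    then have "card ((M \<times> M) \<times> R x) \<le> card (orb ?S x)" unfolding split by (rule card_mono[rotated]) simp
    then show ?thesis by (simp add: card_cartesian_product)
  qed
  have "card (orb ?S y) \<le> card (orb ?S x)" for y
  proof -
    have "card (orb ?S y) \<le> card M * card M * card (R y)" by (rule upper)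
    also have "\<dots> \<le> card M * card M * card (R x)" using y0[of y] by (simp add: Rx)
    also note lower
    finally show ?thesis .
  qed
  with x_pair show ?thesis by blast
qed

section \<open>The surviving transposition of coordinates, and the conclusion\<close>

definition pair_swap :: "point \<Rightarrow> point"
  where "pair_swap = wr id (\<lambda>b. if b = Zero then transpose Zero One else id) (\<lambda>b c. id)"

lemma pair_swap_in_fixer: "(\<And>q. q \<in> Q \<Longrightarrow> q Zero Zero = q Zero One) \<Longrightarrow> pair_swap \<in> fixer W Q"
proof -
  assume const: "\<And>q. q \<in> Q \<Longrightarrow> q Zero Zero = q Zero One"
  have "pair_swap \<in> W" unfolding pair_swap_def by (rule wr_in_W) auto
  moreover have "pair_swap q = q" if "q \<in> Q" for q
    using const[OF that] by (auto simp: pair_swap_def wr_def fun_eq_iff transpose_def)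
  ultimately show ?thesis by (simp add: fixer_def)
qed

lemma pair_swap_neq_id: "pair_swap \<noteq> id"
proof
  assume "pair_swap = id"
  then have "pair_swap (\<lambda>b c. c) Zero Zero = Zero" by simp
  then show False by (simp add: pair_swap_def wr_def)
qed

theorem theorem1p4:
  shows "\<exists>(\<Delta> :: nat set) G.
    finite \<Delta> \<and> subgroup G (BijGroup \<Delta>) \<and>
    solvable (perm_group \<Delta> G) \<and> primitive_perm_group \<Delta> G \<and>
    greedy_base_size \<Delta> G > 4"
proof -
  obtain e :: "point \<Rightarrow> nat" where e: "inj e"
    using finite_imp_inj_to_nat_seg[OF finite] by metis
  let ?\<Delta> = "range e" and ?G = "relabel e ` W"
  \<comment> \<open>The swap of the pair certifies at every step that the algorithm goes on,
    provided that all points chosen so far are constant on the pair.\<close>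
  note greedy = greedy_seq_relabel_step[OF e _ pair_swap_in_fixer pair_swap_neq_id]
  have sub: "subgroup ?G (BijGroup ?\<Delta>)"
    by (rule subgroup_relabel[OF e perm_closed_wr_chain])
  have origin: "origin Zero Zero = Zero" "origin Zero One = Zero" by (simp_all add: origin_def)
  have start: "start Zero Zero = Zero" "start Zero One = Zero" by (simp_all add: start_def)
  have "greedy_seq ?\<Delta> ?G (map e [])" by (simp add: greedy_seq.start)
  then have "greedy_seq ?\<Delta> ?G (map e ([] @ [origin]))"
  proof (rule greedy)
    have "z \<in> orb (fixer W (set [])) y" for y z
      using W_transitive[of y z] by (auto simp: orb_def fixer_def)
    then have "orb (fixer W (set [])) y = UNIV" for y by blast
    then show "card (orb (fixer W (set [])) y) \<le> card (orb (fixer W (set [])) origin)" for y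
      by simp
  qed simp
  then have "greedy_seq ?\<Delta> ?G (map e ([origin] @ [start]))"
    unfolding append_Nil by (rule greedy) (use start_longest origin in auto)
  moreover have "\<exists>u. u Zero Zero = One \<and> u Zero One = One \<and>
      (\<forall>y. card (orb (fixer W {origin, start}) y) \<le> card (orb (fixer W {origin, start}) u))"
    using origin start UNIV_four
    by (intro longest_constant_on_pair[where M = "{One, Two, Three}"]) auto
  then obtain u where u: "u Zero Zero = One" "u Zero One = One"
    "\<And>y. card (orb (fixer W {origin, start}) y) \<le> card (orb (fixer W {origin, start}) u)" by blast
  ultimately have "greedy_seq ?\<Delta> ?G (map e ([origin, start] @ [u]))"
    by (intro greedy) (use origin start in auto)
  \<comment> \<open>With \<open>One\<close> used as well, two values are left, just enough for
    another constant choice.\<close>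
  moreover have "\<exists>t. t Zero Zero = Two \<and> t Zero One = Two \<and>
      (\<forall>y. card (orb (fixer W {origin, start, u}) y) \<le> card (orb (fixer W {origin, start, u}) t))"
    using origin start u UNIV_four
    by (intro longest_constant_on_pair[where M = "{Two, Three}"]) auto
  then obtain t where t: "t Zero Zero = Two" "t Zero One = Two"
    "\<And>y. card (orb (fixer W {origin, start, u}) y) \<le> card (orb (fixer W {origin, start, u}) t)" by blast
  ultimately have seq: "greedy_seq ?\<Delta> ?G (map e ([origin, start, u] @ [t]))"
    by (intro greedy) (use origin start u in auto)
  \<comment> \<open>All four points are constant on the pair, so the swap fixes them and they do not
    form a base.\<close>
  have "relabel e pair_swap \<in> relabel e ` fixer W (set [origin, start, u, t])"
    by (intro imageI pair_swap_in_fixer) (use origin start u t in auto)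
  then have "\<not> perm_base ?\<Delta> ?G (map e [origin, start, u, t])"
    unfolding perm_base_def pointwise_stabilizer_relabel[OF e] relabel_one[OF e]
    using pair_swap_neq_id relabel_eq_iff[OF e] by blast
  then have "greedy_base_size ?\<Delta> ?G > 4"
    using length_less_greedy_base_size[OF _ _ sub seq] by simp
  moreover have "solvable (perm_group ?\<Delta> ?G)"
    by (rule solvable_relabel[OF e perm_closed_wr_chain wr_chain_commutator wr_chain_9])
  moreover have "primitive_perm_group ?\<Delta> ?G"
    by (rule primitive_relabel[OF e perm_closed_wr_chain W_transitive W_primitive])
  moreover have "finite ?\<Delta>" by simp
  ultimately have "finite ?\<Delta> \<and> subgroup ?G (BijGroup ?\<Delta>) \<and> solvable (perm_group ?\<Delta> ?G) \<and>
      primitive_perm_group ?\<Delta> ?G \<and> greedy_base_size ?\<Delta> ?G > 4"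
    using sub by (intro conjI)
  then show ?thesis by (intro exI)
qed

end
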